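(* Let $\mathcal{T}=\sum_{g\in G}T_g|g\rangle$, $\mathcal{X}=\sum_{g\in G}X_g|g\rangle$ and $\mathcal{L}=\sum_{g\in G}L_g|g\rangle$ be tensors in $\mathbb{T}$. Assume that $\mathcal{L}$ is diagonal, with $L_g(|k\rangle)=r_{g}^{(k)}\star|k\rangle$ for all $g,k\in G$, where $r_g^{(k)}\in R$. For $k\in G$, let $\mathcal{X}^{(k)}\in\mathbb{M}$ and $\mathcal{L}_{k,k}\in\mathbb{V}$ be the formal sums $$\mathcal{X}^{(k)}=\sum_{g\in G}X_g(|k\rangle)\,|g\rangle,\qquad \mathcal{L}_{k,k}=\sum_{g\in G}r_g^{(k)}\,|g\rangle .$$ If $\mathcal{T}\star\mathcal{X}=\mathcal{X}\star\mathcal{L}$, then $$\mathcal{T}\star\mathcal{X}^{(k)}=\mathcal{L}_{k,k}\circ\mathcal{X}^{(k)}$$ for each $k\in G$.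
   Context: Let $G$ be an abelian group of finite order $n$ with identity $1_G$, and let $R$ be a commutative ring with identity. For a ring $S$ with identity, the group ring $SG$ is the set of formal sums $\sum_{g\in G} a_g|g\rangle$ with $a_g\in S$, with componentwise addition and with convolution multiplication $\left(\sum_g a_g|g\rangle\right)\star\left(\sum_h b_h|h\rangle\right)=\sum_k\left(\sum_{gh=k}a_g b_h\right)|k\rangle$. Let $\mathbb{V}=RG$, with basis $\{|k\rangle=1_R|k\rangle : k\in G\}$ over $R$; an element $a\in R$ is viewed in $\mathbb{V}$ as $a|1_G\rangle$, so $a\star|k\rangle=a|k\rangle$. Let $\mathbb{M}=\mathbb{V}G$, the set of formal sums $X=\sum_{s\in G}X_s|s\rangle$ with $X_s\in\mathbb{V}$. For $\mathbf{a}=\sum_r \mathbf{a}_r|r\rangle\in\mathbb{V}$ and $X=\sum_s X_s|s\rangle\in\mathbb{M}$, the scalar product is $$\mathbf{a}\circ X=\mathbf{a}\star X=\sum_{g\in G}\Big(\sum_{rs=g}\mathbf{a}_r\star X_s\Big)|g\rangle .$$ Let $\hom_R(\mathbb{V})$ be the ring of $R$-module endomorphisms of $\mathbb{V}$ (pointwise addition, composition), and let $\mathbb{T}=\hom_R(\mathbb{V})G$ be the corresponding group ring; its elements are called tensors, and the product $\star$ of two tensors is the group ring multiplication (convolution using composition of maps). The tensor-matrix product of $T=\sum_g T_g|g\rangle\in\mathbb{T}$ and $X=\sum_s X_s|s\rangle\in\mathbb{M}$ is $$T\star X=\sum_{g\in G}\Big(\sum_{rs=g}T_r(X_s)\Big)|g\rangle\in\mathbb{M}.$$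 A module homomorphism $L\in\hom_R(\mathbb{V})$ is diagonal if for every $k\in G$ we have $L(|k\rangle)=\ell_k\star|k\rangle$ for some $\ell_k\in R$. A tensor $\mathcal{D}=\sum_g D_g|g\rangle\in\mathbb{T}$ is diagonal if each $D_g$ is diagonal. *)

theory Defs
  imports "HOL-Algebra.Module"
begin

text \<open>
  A formal sum over \<open>G\<close> is represented by its coefficient function, extended by
  \<^const>\<open>undefined\<close> outside \<open>carrier G\<close>, so that formal sums are equal exactly if
  their coefficients are. All products of formal sums are convolutions
  \<open>k \<mapsto> \<Sum>\<^bsub>gh=k\<^esub> f (x\<^sub>g) (y\<^sub>h)\<close>, differing only in the pairing \<open>f\<close> of coefficients
  and the structure \<open>S\<close> in which the sum is taken.
\<close>

definition convolution ::
  "('g, 'n) monoid_scheme \<Rightarrow> ('c, 'm) ring_scheme \<Rightarrow> ('a \<Rightarrow> 'b \<Rightarrow> 'c)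
    \<Rightarrow> ('g \<Rightarrow> 'a) \<Rightarrow> ('g \<Rightarrow> 'b) \<Rightarrow> 'g \<Rightarrow> 'c" where
  "convolution G S f x y =
    (\<lambda>k\<in>carrier G. \<Oplus>\<^bsub>S\<^esub>p\<in>{(g, h). g \<in> carrier G \<and> h \<in> carrier G \<and> g \<otimes>\<^bsub>G\<^esub> h = k}.
        f (x (fst p)) (y (snd p)))"

text \<open>The formal sum \<open>a|k\<rangle>\<close>.\<close>

definition monomial ::
  "('a, 'm) ring_scheme \<Rightarrow> ('g, 'n) monoid_scheme \<Rightarrow> 'a \<Rightarrow> 'g \<Rightarrow> 'g \<Rightarrow> 'a" where
  "monomial S G a k = (\<lambda>g\<in>carrier G. if g = k then a else \<zero>\<^bsub>S\<^esub>)"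

definition group_ring ::
  "('a, 'm) ring_scheme \<Rightarrow> ('g, 'n) monoid_scheme \<Rightarrow> ('g \<Rightarrow> 'a) ring" where
  "group_ring S G =
    \<lparr>carrier = carrier G \<rightarrow>\<^sub>E carrier S,
     mult = convolution G S (mult S),
     one = monomial S G \<one>\<^bsub>S\<^esub> \<one>\<^bsub>G\<^esub>,
     zero = (\<lambda>g\<in>carrier G. \<zero>\<^bsub>S\<^esub>),
     add = (\<lambda>x y. \<lambda>g\<in>carrier G. x g \<oplus>\<^bsub>S\<^esub> y g)\<rparr>"

text \<open>
  The group ring \<open>\<V> = RG\<close> as an \<open>R\<close>-module: \<open>a \<in> R\<close> acts through its
  image \<open>a|1\<rangle>\<close> in \<open>\<V>\<close>.
\<close>

definition group_algebra ::
  "('a, 'm) ring_scheme \<Rightarrow> ('g, 'n) monoid_scheme \<Rightarrow> ('a, 'g \<Rightarrow> 'a) module" where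
  "group_algebra R G =
    ring.extend (group_ring R G)
      (module.fields (\<lambda>a v. monomial R G a \<one>\<^bsub>G\<^esub> \<otimes>\<^bsub>group_ring R G\<^esub> v))"

lemma group_algebra_simps [simp]:
  "carrier (group_algebra R G) = carrier (group_ring R G)"
  "mult (group_algebra R G) = mult (group_ring R G)"
  "one (group_algebra R G) = one (group_ring R G)"
  "zero (group_algebra R G) = zero (group_ring R G)"
  "add (group_algebra R G) = add (group_ring R G)"
  "a \<odot>\<^bsub>group_algebra R G\<^esub> v = monomial R G a \<one>\<^bsub>G\<^esub> \<otimes>\<^bsub>group_ring R G\<^esub> v"
  by (simp_all add: group_algebra_def ring.defs module.defs)

definition ket :: "('a, 'm) ring_scheme \<Rightarrow> ('g, 'n) monoid_scheme \<Rightarrow> 'g \<Rightarrow> 'g \<Rightarrow> 'a" where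
  "ket R G k = monomial R G \<one>\<^bsub>R\<^esub> k"

definition module_endos ::
  "('a, 'm) ring_scheme \<Rightarrow> ('a, 'b, 'n) module_scheme \<Rightarrow> ('b \<Rightarrow> 'b) set" where
  "module_endos R M =
    {f \<in> carrier M \<rightarrow>\<^sub>E carrier M.
      (\<forall>v\<in>carrier M. \<forall>w\<in>carrier M. f (v \<oplus>\<^bsub>M\<^esub> w) = f v \<oplus>\<^bsub>M\<^esub> f w) \<and>
      (\<forall>a\<in>carrier R. \<forall>v\<in>carrier M. f (a \<odot>\<^bsub>M\<^esub> v) = a \<odot>\<^bsub>M\<^esub> f v)}"

definition endo_ring ::
  "('a, 'm) ring_scheme \<Rightarrow> ('a, 'b, 'n) module_scheme \<Rightarrow> ('b \<Rightarrow> 'b) ring" where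
  "endo_ring R M =
    \<lparr>carrier = module_endos R M,
     mult = compose (carrier M),
     one = (\<lambda>v\<in>carrier M. v),
     zero = (\<lambda>v\<in>carrier M. \<zero>\<^bsub>M\<^esub>),
     add = (\<lambda>f h. \<lambda>v\<in>carrier M. f v \<oplus>\<^bsub>M\<^esub> h v)\<rparr>"

text \<open>The ring \<open>\<T> = hom\<^sub>R(\<V>)G\<close> of tensors.\<close>

definition tensor_ring ::
  "('a, 'm) ring_scheme \<Rightarrow> ('g, 'n) monoid_scheme
    \<Rightarrow> ('g \<Rightarrow> ('g \<Rightarrow> 'a) \<Rightarrow> 'g \<Rightarrow> 'a) ring" where
  "tensor_ring R G = group_ring (endo_ring R (group_algebra R G)) G"

text \<open>
  The scalar product \<open>a \<circ> X\<close> of \<open>a \<in> \<V>\<close> and \<open>X \<in> \<M> = \<V>G\<close>, with coefficients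
  \<open>a\<^sub>r \<in> R\<close> acting on coefficients \<open>X\<^sub>s \<in> \<V>\<close>.
\<close>

definition scalar_prod ::
  "('a, 'm) ring_scheme \<Rightarrow> ('g, 'n) monoid_scheme
    \<Rightarrow> ('g \<Rightarrow> 'a) \<Rightarrow> ('g \<Rightarrow> 'g \<Rightarrow> 'a) \<Rightarrow> 'g \<Rightarrow> 'g \<Rightarrow> 'a" where
  "scalar_prod R G = convolution G (group_algebra R G) (smult (group_algebra R G))"

definition tensor_matrix_prod ::
  "('a, 'm) ring_scheme \<Rightarrow> ('g, 'n) monoid_scheme
    \<Rightarrow> ('g \<Rightarrow> ('g \<Rightarrow> 'a) \<Rightarrow> 'g \<Rightarrow> 'a) \<Rightarrow> ('g \<Rightarrow> 'g \<Rightarrow> 'a) \<Rightarrow> 'g \<Rightarrow> 'g \<Rightarrow> 'a" where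
  "tensor_matrix_prod R G = convolution G (group_algebra R G) (\<lambda>f v. f v)"

definition diagonal_endo ::
  "('a, 'm) ring_scheme \<Rightarrow> ('g, 'n) monoid_scheme \<Rightarrow> (('g \<Rightarrow> 'a) \<Rightarrow> 'g \<Rightarrow> 'a) \<Rightarrow> bool" where
  "diagonal_endo R G f \<longleftrightarrow>
    f \<in> module_endos R (group_algebra R G) \<and>
    (\<forall>k\<in>carrier G. \<exists>l\<in>carrier R. f (ket R G k) = l \<odot>\<^bsub>group_algebra R G\<^esub> ket R G k)"

definition diagonal_tensor ::
  "('a, 'm) ring_scheme \<Rightarrow> ('g, 'n) monoid_scheme
    \<Rightarrow> ('g \<Rightarrow> ('g \<Rightarrow> 'a) \<Rightarrow> 'g \<Rightarrow> 'a) \<Rightarrow> bool" where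
  "diagonal_tensor R G D \<longleftrightarrow>
    D \<in> carrier (tensor_ring R G) \<and> (\<forall>g\<in>carrier G. diagonal_endo R G (D g))"

end

theory Submission
  imports Defs
begin

text \<open>
  Evaluation at a fixed basis vector \<open>|k\<rangle>\<close> is an additive map from \<open>hom\<^sub>R(\<V>)\<close> to \<open>\<V>\<close>, so it
  commutes with the sums in a convolution. It turns the coefficient of \<open>\<T> \<star> \<X>\<close> at \<open>g\<close> into
  \<open>\<Sum>\<^bsub>rs=g\<^esub> T\<^sub>r(X\<^sub>s|k\<rangle>)\<close>, which is the coefficient of \<open>\<T> \<star> \<X>\<^sup>k\<close>, where \<open>\<X>\<^sup>k\<close> denotes the
  \<open>k\<close>-th column of \<open>\<X>\<close>. It turns the coefficient of \<open>\<X> \<star> \<L>\<close> into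
  \<open>\<Sum>\<^bsub>rs=g\<^esub> X\<^sub>r(L\<^sub>s|k\<rangle>)\<close>; since \<open>L\<^sub>s|k\<rangle>\<close> is a scalar multiple of \<open>|k\<rangle>\<close> and \<open>X\<^sub>r\<close> is linear, the
  scalar moves out of \<open>X\<^sub>r\<close>, to the left. As \<open>G\<close> is commutative, the summation index
  \<open>(r, s)\<close> may be swapped to \<open>(s, r)\<close>, and the sum becomes the coefficient of
  \<open>\<L>\<^bsub>k,k\<^esub> \<circ> \<X>\<^sup>k\<close>.

  The lemma \<open>convolution_compose_apply\<close> is the evaluation step. It needs \<open>hom\<^sub>R(\<V>)\<close> to be a
  commutative monoid under addition, which rests on the scalar multiplication of \<open>\<V>\<close>
  being additive in the vector.
\<close>

section \<open>Convolutions\<close>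

lemma convolution_closed:
  assumes "abelian_monoid S"
    and "\<And>g h. g \<in> carrier G \<Longrightarrow> h \<in> carrier G \<Longrightarrow> f (x g) (y h) \<in> carrier S"
  shows "convolution G S f x y \<in> carrier G \<rightarrow>\<^sub>E carrier S"
  unfolding convolution_def
  by (rule restrict_PiE_iff[THEN iffD2], rule ballI,
      rule abelian_monoid.finsum_closed[OF assms(1)]) (use assms(2) in auto)

lemma convolution_add_right:
  assumes S: "abelian_monoid S"
    and y: "\<And>g h. g \<in> carrier G \<Longrightarrow> h \<in> carrier G \<Longrightarrow> f (x g) (y h) \<in> carrier S"
    and z: "\<And>g h. g \<in> carrier G \<Longrightarrow> h \<in> carrier G \<Longrightarrow> f (x g) (z h) \<in> carrier S"
    and add: "\<And>g h. g \<in> carrier G \<Longrightarrow> h \<in> carrier G \<Longrightarrow>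
      f (x g) (w h) = f (x g) (y h) \<oplus>\<^bsub>S\<^esub> f (x g) (z h)"
  shows "convolution G S f x w =
    (\<lambda>k\<in>carrier G. convolution G S f x y k \<oplus>\<^bsub>S\<^esub> convolution G S f x z k)"
proof (rule ext)
  fix k
  interpret abelian_monoid S by fact
  let ?P = "{(g, h). g \<in> carrier G \<and> h \<in> carrier G \<and> g \<otimes>\<^bsub>G\<^esub> h = k}"
  have "(\<Oplus>\<^bsub>S\<^esub>p\<in>?P. f (x (fst p)) (w (snd p))) =
      (\<Oplus>\<^bsub>S\<^esub>p\<in>?P. f (x (fst p)) (y (snd p)) \<oplus>\<^bsub>S\<^esub> f (x (fst p)) (z (snd p)))"
    by (rule finsum_cong') (use y z add in auto)
  also have "\<dots> = (\<Oplus>\<^bsub>S\<^esub>p\<in>?P. f (x (fst p)) (y (snd p))) \<oplus>\<^bsub>S\<^esub>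
      (\<Oplus>\<^bsub>S\<^esub>p\<in>?P. f (x (fst p)) (z (snd p)))"
    by (rule finsum_addf) (use y z in auto)
  finally show "convolution G S f x w k =
      (\<lambda>k\<in>carrier G. convolution G S f x y k \<oplus>\<^bsub>S\<^esub> convolution G S f x z k) k"
    by (simp add: convolution_def)
qed

text \<open>
  If \<open>G\<close> is commutative, \<open>(g, h) \<mapsto> (h, g)\<close> permutes the pairs with product \<open>k\<close>.
\<close>

lemma (in comm_group) convolution_swap:
  assumes "abelian_monoid S"
    and "\<And>g h. g \<in> carrier G \<Longrightarrow> h \<in> carrier G \<Longrightarrow> f (x g) (y h) \<in> carrier S"
  shows "convolution G S f x y = convolution G S (\<lambda>b a. f a b) y x"
proof (rule ext)
  fix k
  interpret S: abelian_monoid S by fact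
  let ?P = "{(g, h). g \<in> carrier G \<and> h \<in> carrier G \<and> g \<otimes> h = k}"
  have swap: "inj_on prod.swap ?P" "prod.swap ` ?P = ?P"
    by (auto simp: m_comm intro!: image_eqI[where x = "prod.swap _"])
  have "(\<Oplus>\<^bsub>S\<^esub>p\<in>prod.swap ` ?P. f (x (fst p)) (y (snd p))) =
      (\<Oplus>\<^bsub>S\<^esub>p\<in>?P. f (x (fst (prod.swap p))) (y (snd (prod.swap p))))"
    by (rule S.finsum_reindex) (use assms(2) swap in auto)
  then show "convolution G S f x y k = convolution G S (\<lambda>b a. f a b) y x k"
    by (simp add: convolution_def swap(2))
qed

lemma finsum_hom:
  assumes A: "abelian_monoid A" and B: "abelian_monoid B"
    and closed: "\<And>a. a \<in> carrier A \<Longrightarrow> h a \<in> carrier B"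
    and zero: "h \<zero>\<^bsub>A\<^esub> = \<zero>\<^bsub>B\<^esub>"
    and add: "\<And>a b. a \<in> carrier A \<Longrightarrow> b \<in> carrier A \<Longrightarrow> h (a \<oplus>\<^bsub>A\<^esub> b) = h a \<oplus>\<^bsub>B\<^esub> h b"
    and f: "f \<in> P \<rightarrow> carrier A"
  shows "h (\<Oplus>\<^bsub>A\<^esub>p\<in>P. f p) = (\<Oplus>\<^bsub>B\<^esub>p\<in>P. h (f p))"
proof -
  interpret A: abelian_monoid A by fact
  interpret B: abelian_monoid B by fact
  show ?thesis
    using f
  proof (induction P rule: infinite_finite_induct)
    case (insert p P)
    then have "f p \<in> carrier A" and "f \<in> P \<rightarrow> carrier A" by auto
    moreover from this have "(\<lambda>p. h (f p)) \<in> P \<rightarrow> carrier B" using closed by auto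
    ultimately show ?case using insert.IH insert.hyps by (simp add: add closed)
  qed (simp_all add: zero)
qed

section \<open>The group ring and its scalars\<close>

lemma group_ring_abelian_monoid:
  assumes "abelian_monoid S"
  shows "abelian_monoid (group_ring S G)"
proof -
  interpret abelian_monoid S by fact
  show ?thesis
    by (rule abelian_monoidI)
      (auto simp: group_ring_def PiE_iff a_ac extensional_def intro!: ext)
qed

lemma group_algebra_abelian_monoid:
  assumes "abelian_monoid R"
  shows "abelian_monoid (group_algebra R G)"
proof -
  interpret V: abelian_monoid "group_ring R G" by (rule group_ring_abelian_monoid) fact
  show ?thesis
    by (rule abelian_monoidI) (simp_all add: V.a_ac)
qed

lemma group_algebra_smult_closed:
  assumes "ring R" "a \<in> carrier R" "v \<in> carrier (group_algebra R G)"
  shows "a \<odot>\<^bsub>group_algebra R G\<^esub> v \<in> carrier (group_algebra R G)"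
proof -
  interpret ring R by fact
  show ?thesis
    using assms(2,3)
    unfolding group_algebra_simps group_ring_def monoid.simps ring.simps partial_object.simps
    by (intro convolution_closed[OF abelian_monoid_axioms]) (auto simp: monomial_def)
qed

lemma group_algebra_smult_add:
  assumes "ring R" "a \<in> carrier R"
    and "v \<in> carrier (group_algebra R G)" "w \<in> carrier (group_algebra R G)"
  shows "a \<odot>\<^bsub>group_algebra R G\<^esub> (v \<oplus>\<^bsub>group_algebra R G\<^esub> w) =
    a \<odot>\<^bsub>group_algebra R G\<^esub> v \<oplus>\<^bsub>group_algebra R G\<^esub> a \<odot>\<^bsub>group_algebra R G\<^esub> w"
proof -
  interpret ring R by fact
  have "monomial R G a \<one>\<^bsub>G\<^esub> g \<in> carrier R" if "g \<in> carrier G" for g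
    using that assms(2) by (simp add: monomial_def)
  then show ?thesis
    using assms(3,4)
    by (auto simp: group_ring_def PiE_iff r_distr
        intro!: convolution_add_right[OF abelian_monoid_axioms])
qed

lemma group_algebra_smult_zero:
  assumes "ring R" "a \<in> carrier R"
  shows "a \<odot>\<^bsub>group_algebra R G\<^esub> \<zero>\<^bsub>group_algebra R G\<^esub> = \<zero>\<^bsub>group_algebra R G\<^esub>"
proof -
  interpret ring R by fact
  show ?thesis
    using assms(2)
    by (auto simp: group_ring_def convolution_def monomial_def
        intro!: restrict_ext add.finprod_one_eqI)
qed

section \<open>Evaluation of endomorphisms\<close>

text \<open>
  Additivity of the scalar multiplication in the vector makes a sum of linear maps linear,
  and \<open>a \<odot> 0 = 0\<close> makes the zero map linear.
\<close>

lemma endo_ring_abelian_monoid: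
  assumes M: "abelian_monoid M"
    and smult_closed: "\<And>a v. a \<in> carrier R \<Longrightarrow> v \<in> carrier M \<Longrightarrow> a \<odot>\<^bsub>M\<^esub> v \<in> carrier M"
    and smult_add: "\<And>a v w. a \<in> carrier R \<Longrightarrow> v \<in> carrier M \<Longrightarrow> w \<in> carrier M \<Longrightarrow>
      a \<odot>\<^bsub>M\<^esub> (v \<oplus>\<^bsub>M\<^esub> w) = a \<odot>\<^bsub>M\<^esub> v \<oplus>\<^bsub>M\<^esub> a \<odot>\<^bsub>M\<^esub> w"
    and smult_zero: "\<And>a. a \<in> carrier R \<Longrightarrow> a \<odot>\<^bsub>M\<^esub> \<zero>\<^bsub>M\<^esub> = \<zero>\<^bsub>M\<^esub>"
  shows "abelian_monoid (endo_ring R M)"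
proof -
  interpret abelian_monoid M by fact
  have endo: "f v \<in> carrier M" "f (v \<oplus>\<^bsub>M\<^esub> w) = f v \<oplus>\<^bsub>M\<^esub> f w"
      "a \<in> carrier R \<Longrightarrow> f (a \<odot>\<^bsub>M\<^esub> v) = a \<odot>\<^bsub>M\<^esub> f v"
    if "f \<in> module_endos R M" "v \<in> carrier M" "w \<in> carrier M" for f v w a
    using that by (auto simp: module_endos_def)
  have ext: "f v = undefined" if "f \<in> module_endos R M" "v \<notin> carrier M" for f v
    using that by (auto simp: module_endos_def)
  show ?thesis
  proof (rule abelian_monoidI)
    fix f h assume "f \<in> carrier (endo_ring R M)" "h \<in> carrier (endo_ring R M)"
    then have fh: "f \<in> module_endos R M" "h \<in> module_endos R M"
      by (simp_all add: endo_ring_def)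
    show "f \<oplus>\<^bsub>endo_ring R M\<^esub> h \<in> carrier (endo_ring R M)"
      unfolding endo_ring_def using endo[OF fh(1)] endo[OF fh(2)]
      by (auto simp: module_endos_def smult_closed smult_add a_ac)
    show "f \<oplus>\<^bsub>endo_ring R M\<^esub> h = h \<oplus>\<^bsub>endo_ring R M\<^esub> f"
      unfolding endo_ring_def using endo(1)[OF fh(1)] endo(1)[OF fh(2)]
      by (auto simp: a_ac intro!: restrict_ext)
  next
    show "\<zero>\<^bsub>endo_ring R M\<^esub> \<in> carrier (endo_ring R M)"
      by (auto simp: endo_ring_def module_endos_def smult_closed smult_zero)
  qed (auto simp: endo_ring_def endo(1) ext a_assoc intro!: ext)
qed

text \<open>
  Evaluation at \<open>v\<close> is additive, so it passes through the sum in the group ring of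
  endomorphisms, and it takes each composite \<open>f \<circ> h\<close> to \<open>f (h v)\<close>. Closure of \<open>M\<close> under
  scalars ensures that the composites are again endomorphisms, so that the sum is taken
  inside the endomorphism ring.
\<close>

lemma convolution_compose_apply:
  assumes M: "abelian_monoid M" and E: "abelian_monoid (endo_ring R M)"
    and smult_closed: "\<And>a v. a \<in> carrier R \<Longrightarrow> v \<in> carrier M \<Longrightarrow> a \<odot>\<^bsub>M\<^esub> v \<in> carrier M"
    and A: "A \<in> carrier (group_ring (endo_ring R M) G)"
    and B: "B \<in> carrier (group_ring (endo_ring R M) G)"
    and v: "v \<in> carrier M" and k: "k \<in> carrier G"
  shows "(A \<otimes>\<^bsub>group_ring (endo_ring R M) G\<^esub> B) k v =
    convolution G M (\<lambda>f w. f w) A (\<lambda>g\<in>carrier G. B g v) k"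
proof -
  interpret M: abelian_monoid M by fact
  let ?E = "endo_ring R M"
  let ?P = "{(g, h). g \<in> carrier G \<and> h \<in> carrier G \<and> g \<otimes>\<^bsub>G\<^esub> h = k}"
  have mem: "A g \<in> module_endos R M" "B g \<in> module_endos R M" if "g \<in> carrier G" for g
    using A B that by (auto simp: group_ring_def endo_ring_def)
  have closed: "f w \<in> carrier M" if "f \<in> module_endos R M" "w \<in> carrier M" for f w
    using that by (auto simp: module_endos_def)
  have comp: "compose (carrier M) f h \<in> carrier ?E"
    if "f \<in> module_endos R M" "h \<in> module_endos R M" for f h
    using that smult_closed closed
    by (auto simp: endo_ring_def module_endos_def compose_def)
  have "(A \<otimes>\<^bsub>group_ring ?E G\<^esub> B) k v =
      (\<Oplus>\<^bsub>?E\<^esub>p\<in>?P. compose (carrier M) (A (fst p)) (B (snd p))) v"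
    using k by (simp add: group_ring_def convolution_def endo_ring_def)
  also have "\<dots> = (\<Oplus>\<^bsub>M\<^esub>p\<in>?P. compose (carrier M) (A (fst p)) (B (snd p)) v)"
    by (rule finsum_hom[OF E M, where h = "\<lambda>f. f v"])
      (use v mem comp closed in \<open>auto simp: endo_ring_def\<close>)
  also have "\<dots> = (\<Oplus>\<^bsub>M\<^esub>p\<in>?P. A (fst p) ((\<lambda>g\<in>carrier G. B g v) (snd p)))"
    by (rule M.finsum_cong') (use v mem closed in \<open>auto simp: compose_eq\<close>)
  finally show ?thesis using k by (simp add: convolution_def)
qed

theorem theorem6:
  fixes R :: "('a, 'm) ring_scheme"
    and G :: "('g, 'n) monoid_scheme"
    and T X L :: "'g \<Rightarrow> ('g \<Rightarrow> 'a) \<Rightarrow> 'g \<Rightarrow> 'a"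
    and r :: "'g \<Rightarrow> 'g \<Rightarrow> 'a"
  assumes "cring R"
    and "comm_group G"
    and "finite (carrier G)"
    and "T \<in> carrier (tensor_ring R G)"
    and "X \<in> carrier (tensor_ring R G)"
    and "L \<in> carrier (tensor_ring R G)"
    and "diagonal_tensor R G L"
    and "\<And>g k. g \<in> carrier G \<Longrightarrow> k \<in> carrier G \<Longrightarrow> r g k \<in> carrier R"
    and "\<And>g k. g \<in> carrier G \<Longrightarrow> k \<in> carrier G \<Longrightarrow>
           L g (ket R G k) = r g k \<odot>\<^bsub>group_algebra R G\<^esub> ket R G k"
    and "T \<otimes>\<^bsub>tensor_ring R G\<^esub> X = X \<otimes>\<^bsub>tensor_ring R G\<^esub> L"
  shows "\<forall>k\<in>carrier G.
           tensor_matrix_prod R G T (\<lambda>g\<in>carrier G. X g (ket R G k)) =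
           scalar_prod R G (\<lambda>g\<in>carrier G. r g k) (\<lambda>g\<in>carrier G. X g (ket R G k))"
proof
  fix k assume k: "k \<in> carrier G"
  interpret R: cring R by fact
  interpret G: comm_group G by fact
  let ?V = "group_algebra R G"
  let ?col = "\<lambda>Y. \<lambda>g\<in>carrier G. Y g (ket R G k)"
  let ?l = "\<lambda>g\<in>carrier G. r g k"
  have V: "abelian_monoid ?V"
    by (rule group_algebra_abelian_monoid) (rule R.abelian_monoid_axioms)
  interpret V: abelian_monoid ?V by (rule V)
  note smult_closed = group_algebra_smult_closed[OF R.ring_axioms]
  have E: "abelian_monoid (endo_ring R ?V)"
    by (rule endo_ring_abelian_monoid[OF V smult_closed
          group_algebra_smult_add[OF R.ring_axioms] group_algebra_smult_zero[OF R.ring_axioms]])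
  have ket: "ket R G k \<in> carrier ?V"
    by (auto simp: ket_def monomial_def group_ring_def)
  have X: "X g \<in> module_endos R ?V" if "g \<in> carrier G" for g
    using assms(5) that by (auto simp: tensor_ring_def group_ring_def endo_ring_def)
  have Xket: "X g (ket R G k) \<in> carrier ?V" if "g \<in> carrier G" for g
    using X[OF that] ket by (auto simp: module_endos_def)
  have Xlin: "X g (a \<odot>\<^bsub>?V\<^esub> ket R G k) = a \<odot>\<^bsub>?V\<^esub> X g (ket R G k)"
    if "g \<in> carrier G" "a \<in> carrier R" for g a
    using X[OF that(1)] that(2) ket unfolding module_endos_def by blast
  have apply_ket: "(A \<otimes>\<^bsub>tensor_ring R G\<^esub> B) g (ket R G k) =
      tensor_matrix_prod R G A (?col B) g"
    if "A \<in> carrier (tensor_ring R G)" "B \<in> carrier (tensor_ring R G)" "g \<in> carrier G" for A B g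
    using convolution_compose_apply[OF V E smult_closed _ _ ket] that
    by (simp add: tensor_ring_def tensor_matrix_prod_def)
  have "tensor_matrix_prod R G T (?col X) = tensor_matrix_prod R G X (?col L)"
  proof (rule extensionalityI[where A = "carrier G"])
    fix g assume "g \<in> carrier G"
    then show "tensor_matrix_prod R G T (?col X) g = tensor_matrix_prod R G X (?col L) g"
      using apply_ket assms(4,5,6,10) by metis
  qed (simp_all add: tensor_matrix_prod_def convolution_def)
  also have "\<dots> = convolution G ?V (\<lambda>v a. a \<odot>\<^bsub>?V\<^esub> v) (?col X) ?l"
    unfolding tensor_matrix_prod_def convolution_def
  proof (intro restrict_ext V.finsum_cong' refl)
    fix g p
    assume "p \<in> {(s, t). s \<in> carrier G \<and> t \<in> carrier G \<and> s \<otimes>\<^bsub>G\<^esub> t = g}"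
    then have p: "fst p \<in> carrier G" "snd p \<in> carrier G" by auto
    show "X (fst p) (?col L (snd p)) = ?l (snd p) \<odot>\<^bsub>?V\<^esub> ?col X (fst p)"
      using p k Xlin assms(8,9) by (simp del: group_algebra_simps)
  qed (use k Xket assms(8) in \<open>auto intro!: smult_closed simp del: group_algebra_simps\<close>)
  also have "\<dots> = scalar_prod R G ?l (?col X)"
    unfolding scalar_prod_def
    by (subst G.convolution_swap[OF V])
      (use k Xket assms(8) in \<open>auto intro!: smult_closed simp del: group_algebra_simps\<close>)
  finally show "tensor_matrix_prod R G T (?col X) = scalar_prod R G ?l (?col X)" .
qed

end
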